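(* Let $n\geq 4$ be an integer. Then $K_n$ and $K_n+K_{n-1}$ are Ramsey equivalent; that is, for every finite simple graph $G$, we have $G\to K_n$ if and only if $G\to K_n+K_{n-1}$.
   Context: All graphs are finite and simple. For graphs $G,H$, $G\to H$ ($G$ is Ramsey for $H$) means that every colouring of the edges of $G$ with the two colours red and blue contains a monochromatic copy of $H$ (a subgraph isomorphic to $H$ all of whose edges have the same colour). Two graphs $H_1,H_2$ are Ramsey equivalent if for every graph $G$, $G\to H_1$ holds if and only if $G\to H_2$ holds. $K_m$ is the complete graph on $m$ vertices, and $H_1+H_2$ denotes the disjoint union of a copy of $H_1$ and a vertex-disjoint copy of $H_2$. *)

theory Defs
  imports "HOL-Library.Ramsey"
begin

record 'v graph =
  verts :: "'v set"
  edges :: "'v set set"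

text \<open>
  \<open>[A]\<^bsup>2\<^esup>\<close> is the set of two-element subsets of \<open>A\<close>, so loops and multiple edges are excluded.
\<close>

definition simple_graph :: "'v graph \<Rightarrow> bool" where
  "simple_graph G \<longleftrightarrow> finite (verts G) \<and> edges G \<subseteq> [verts G]\<^bsup>2\<^esup>"

definition subgraph :: "'v graph \<Rightarrow> 'v graph \<Rightarrow> bool" where
  "subgraph F G \<longleftrightarrow>
     simple_graph F \<and> simple_graph G \<and> verts F \<subseteq> verts G \<and> edges F \<subseteq> edges G"

definition isomorphic :: "'u graph \<Rightarrow> 'v graph \<Rightarrow> bool" where
  "isomorphic G H \<longleftrightarrow>
     (\<exists>f. bij_betw f (verts G) (verts H) \<and>
          (\<forall>u\<in>verts G. \<forall>v\<in>verts G. {u, v} \<in> edges G \<longleftrightarrow> {f u, f v} \<in> edges H))"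

definition complete_graph :: "nat \<Rightarrow> nat graph" where
  "complete_graph m = \<lparr> verts = {..<m}, edges = [{..<m}]\<^bsup>2\<^esup> \<rparr>"

definition disjoint_union :: "'u graph \<Rightarrow> 'v graph \<Rightarrow> ('u + 'v) graph" where
  "disjoint_union G H =
     \<lparr> verts = verts G <+> verts H,
       edges = (image Inl) ` edges G \<union> (image Inr) ` edges H \<rparr>"

lemma simple_graph_complete_graph: "simple_graph (complete_graph m)"
  by (simp add: simple_graph_def complete_graph_def)

lemma simple_graph_disjoint_union:
  assumes "simple_graph G" "simple_graph H"
  shows "simple_graph (disjoint_union G H)"
proof -
  have "image Inl e \<in> [verts G <+> verts H]\<^bsup>2\<^esup>" if "e \<in> edges G" for e
    using assms(1) that by (auto simp: simple_graph_def elim!: nsets2_E dest!: subsetD)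
  moreover have "image Inr e \<in> [verts G <+> verts H]\<^bsup>2\<^esup>" if "e \<in> edges H" for e
    using assms(2) that by (auto simp: simple_graph_def elim!: nsets2_E dest!: subsetD)
  ultimately show ?thesis
    using assms unfolding simple_graph_def disjoint_union_def by auto
qed

datatype colour = Red | Blue

definition monochromatic_copy ::
  "('v set \<Rightarrow> colour) \<Rightarrow> 'u graph \<Rightarrow> 'v graph \<Rightarrow> bool" where
  "monochromatic_copy c H G \<longleftrightarrow>
     (\<exists>F k. subgraph F G \<and> isomorphic H F \<and> (\<forall>e\<in>edges F. c e = k))"

text \<open>
  Colourings are total functions on sets of vertices; their values outside \<open>edges G\<close> are irrelevant,
  as only edges of subgraphs of \<open>G\<close> are inspected.
\<close>

definition ramsey :: "'v graph \<Rightarrow> 'u graph \<Rightarrow> bool" where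
  "ramsey G H \<longleftrightarrow> (\<forall>c. monochromatic_copy c H G)"

text \<open>
  A definition cannot quantify over the type of the vertices of \<open>G\<close>, so that type is an explicit
  argument. Ramsey equivalence of two graphs is this predicate for every type \<open>'v\<close>; any infinite
  \<open>'v\<close> already contains an isomorphic copy of every finite graph.
\<close>

definition ramsey_equivalent :: "'v itself \<Rightarrow> 'a graph \<Rightarrow> 'b graph \<Rightarrow> bool" where
  "ramsey_equivalent _ H1 H2 \<longleftrightarrow>
     (\<forall>G :: 'v graph. simple_graph G \<longrightarrow> (ramsey G H1 \<longleftrightarrow> ramsey G H2))"

end

theory Submission
  imports Defs
begin

text \<open>
  Suppose that a colouring \<open>c\<close> of \<open>G\<close> has no monochromatic \<open>K\<^sub>n + K\<^sub>n\<^sub>-\<^sub>1\<close>, so that every red \<open>K\<^sub>n\<close> meets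
  every red \<open>K\<^sub>n\<^sub>-\<^sub>1\<close>, and likewise in blue. Choose disjoint sets \<open>A\<close>, \<open>B\<close> of at most \<open>n - 1\<close> vertices,
  \<open>A\<close> meeting all red and \<open>B\<close> all blue \<open>K\<^sub>n\<close>. Colour \<open>A\<close> blue inside and, to the outside, red
  except that \<open>a\<close> is joined in blue to a red clique \<open>f a\<close> which meets every red \<open>K\<^sub>n\<^sub>-\<^sub>1\<close> avoiding \<open>A\<close>;
  treat \<open>B\<close> in the same way with the colours exchanged. A new red clique has at most one vertex in
  \<open>A\<close>, and at most one outside \<open>A \<union> B\<close> once it meets \<open>B\<close>; a mixed colouring of the
  edges between \<open>A\<close> and \<open>B\<close> then keeps its size below \<open>n\<close>.

  For distinct red cliques \<open>S\<close>, \<open>S'\<close> of size \<open>n\<close> and \<open>x \<in> S - S'\<close> one takes \<open>A = S - {x}\<close>, with both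
  disjoint sets \<open>{x}\<close> and \<open>S' - S\<close> among the \<open>f a\<close>; if \<open>S\<close> is the only red \<open>K\<^sub>n\<close>, one takes
  \<open>A = S - T\<close> with \<open>card T = 2\<close> and \<open>f a = T\<close>. A red and a blue clique share at most one vertex \<open>v\<close>, so
  \<open>A\<close> and \<open>B\<close> can be made disjoint unless all monochromatic \<open>K\<^sub>n\<close> contain \<open>v\<close>, and then \<open>A = {v}\<close>,
  \<open>B = {}\<close> works.
\<close>

definition mono_clique :: "'v graph \<Rightarrow> ('v set \<Rightarrow> colour) \<Rightarrow> colour \<Rightarrow> 'v set \<Rightarrow> bool" where
  "mono_clique G c k C \<longleftrightarrow>
     C \<subseteq> verts G \<and> (\<forall>u\<in>C. \<forall>v\<in>C. u \<noteq> v \<longrightarrow> {u, v} \<in> edges G \<and> c {u, v} = k)"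

lemma mono_clique_subset: "mono_clique G c k C \<Longrightarrow> D \<subseteq> C \<Longrightarrow> mono_clique G c k D"
  unfolding mono_clique_def by blast

lemma mono_clique_cong:
  assumes "\<And>u v. u \<in> C \<Longrightarrow> v \<in> C \<Longrightarrow> c {u, v} = d {u, v}"
  shows "mono_clique G c k C \<longleftrightarrow> mono_clique G d k C"
  using assms unfolding mono_clique_def by auto

lemma mono_clique_colour:
  "mono_clique G c k C \<Longrightarrow> u \<in> C \<Longrightarrow> v \<in> C \<Longrightarrow> u \<noteq> v \<Longrightarrow> c {u, v} = k"
  unfolding mono_clique_def by blast

subsection \<open>Monochromatic copies as sets of vertices\<close>

lemma monochromatic_copy_iff:
  "monochromatic_copy c H G \<longleftrightarrow>
     simple_graph G \<and> (\<exists>F k. simple_graph F \<and> verts F \<subseteq> verts G \<and> edges F \<subseteq> edges G \<and>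
       isomorphic H F \<and> (\<forall>e\<in>edges F. c e = k))"
  unfolding monochromatic_copy_def subgraph_def by auto

lemma mono_clique_imp_copy:
  assumes G: "simple_graph G" and C: "mono_clique G c k C" "card C = n" "finite C"
  shows "monochromatic_copy c (complete_graph n) G"
proof -
  let ?F = "\<lparr>verts = C, edges = [C]\<^bsup>2\<^esup>\<rparr>"
  obtain f where f: "bij_betw f {..<n} C"
    using C(2,3) by (metis card_lessThan finite_lessThan finite_same_card_bij)
  have "[C]\<^bsup>2\<^esup> \<subseteq> edges G" "\<forall>e\<in>[C]\<^bsup>2\<^esup>. c e = k"
    using C(1) by (auto simp: mono_clique_def elim!: nsets2_E)
  moreover have "isomorphic (complete_graph n) ?F"
    unfolding isomorphic_def complete_graph_def
    using f by (intro exI[of _ f]) (auto simp: bij_betw_def inj_on_def)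
  ultimately show ?thesis
    unfolding monochromatic_copy_iff using G C
    by (intro conjI exI[of _ ?F] exI[of _ k]) (auto simp: simple_graph_def mono_clique_def)
qed

text \<open>The isomorphism carries a clique \<open>K\<close> of \<open>H\<close> onto a clique of
  the copy. \<open>H\<close> stays general so that both the complete graph and the disjoint union
  are covered.\<close>

lemma copy_imp_mono_clique:
  assumes "monochromatic_copy c H G" "finite K" "K \<subseteq> verts H" "[K]\<^bsup>2\<^esup> \<subseteq> edges H"
  shows "\<exists>k C. mono_clique G c k C \<and> card C = card K \<and> finite C"
proof -
  obtain F k f where F: "simple_graph F" "verts F \<subseteq> verts G" "edges F \<subseteq> edges G"
      "\<forall>e\<in>edges F. c e = k"
    and f: "bij_betw f (verts H) (verts F)"
      "\<forall>u\<in>verts H. \<forall>v\<in>verts H. {u, v} \<in> edges H \<longleftrightarrow> {f u, f v} \<in> edges F"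
    using assms(1) unfolding monochromatic_copy_iff isomorphic_def by blast
  have "{f u, f v} \<in> edges F" if "u \<in> K" "v \<in> K" "f u \<noteq> f v" for u v
  proof -
    have "{u, v} \<in> edges H"
      using that assms(4) by (intro subsetD[OF assms(4)]) auto
    then show ?thesis
      using f(2) that assms(3) by blast
  qed
  moreover have "f ` K \<subseteq> verts F"
    using f(1) assms(3) by (auto simp: bij_betw_def)
  ultimately have "mono_clique G c k (f ` K)"
    using F unfolding mono_clique_def by blast
  moreover have "card (f ` K) = card K"
    using f(1) assms(3) by (meson bij_betw_def card_image inj_on_subset)
  ultimately show ?thesis
    using assms(2) by blast
qed

lemma mono_cliques_imp_copy:
  assumes G: "simple_graph G"
    and C: "mono_clique G c k C" "card C = n" "finite C"
    and D: "mono_clique G c k D" "card D = m" "finite D"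
    and disj: "C \<inter> D = {}"
  shows "monochromatic_copy c (disjoint_union (complete_graph n) (complete_graph m)) G"
proof -
  \<comment> \<open>Subgraphs need not be induced, so edges of \<open>G\<close> between
    \<open>C\<close> and \<open>D\<close> are simply left out.\<close>
  let ?F = "\<lparr>verts = C \<union> D, edges = [C]\<^bsup>2\<^esup> \<union> [D]\<^bsup>2\<^esup>\<rparr>"
  let ?H = "disjoint_union (complete_graph n) (complete_graph m)"
  obtain f where f: "bij_betw f {..<n} C"
    using C(2,3) by (metis card_lessThan finite_lessThan finite_same_card_bij)
  obtain g where g: "bij_betw g {..<m} D"
    using D(2,3) by (metis card_lessThan finite_lessThan finite_same_card_bij)
  let ?h = "case_sum f g"
  have edgesF: "edges ?F \<subseteq> edges G" "\<forall>e\<in>edges ?F. c e = k"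
    using C(1) D(1) by (auto simp: mono_clique_def elim!: nsets2_E)
  have F: "simple_graph ?F"
    using C(3) D(3) by (auto simp: simple_graph_def elim!: nsets2_E)
  have img: "f x \<in> C" "x < n \<Longrightarrow> y < n \<Longrightarrow> f x = f y \<longleftrightarrow> x = y" if "x < n" for x y
    using f that by (auto simp: bij_betw_def inj_on_def)
  have img': "g x \<in> D" "x < m \<Longrightarrow> y < m \<Longrightarrow> g x = g y \<longleftrightarrow> x = y" if "x < m" for x y
    using g that by (auto simp: bij_betw_def inj_on_def)
  have fg: "f x \<noteq> g y" if "x < n" "y < m" for x y
    using img(1)[OF that(1)] img'(1)[OF that(2)] disj by auto
  have vertsH: "verts ?H = {..<n} <+> {..<m}"
    by (simp add: disjoint_union_def complete_graph_def)
  have bij: "bij_betw ?h (verts ?H) (verts ?F)"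
  proof -
    have "inj_on ?h ({..<n} <+> {..<m})"
      using img(2) img'(2) fg by (intro inj_onI) (auto simp: eq_commute[of "g _" "f _"])
    moreover have "?h ` ({..<n} <+> {..<m}) = C \<union> D"
    proof -
      have "f ` {..<n} = C" "g ` {..<m} = D"
        using f g by (auto simp: bij_betw_def)
      then show ?thesis
        by (simp add: Plus_def image_Un image_image)
    qed
    ultimately show ?thesis
      by (simp add: vertsH bij_betw_def)
  qed
  have edgesH: "{u, v} \<in> edges ?H \<longleftrightarrow>
      (\<exists>x y. x \<noteq> y \<and> x < n \<and> y < n \<and> u = Inl x \<and> v = Inl y) \<or>
      (\<exists>x y. x \<noteq> y \<and> x < m \<and> y < m \<and> u = Inr x \<and> v = Inr y)" for u v
  proof -
    have 1: "{u, v} \<in> image Inl ` [{..<n}]\<^bsup>2\<^esup> \<longleftrightarrow>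
      (\<exists>x y. x \<noteq> y \<and> x < n \<and> y < n \<and> u = Inl x \<and> v = Inl y)" (is "?l \<longleftrightarrow> ?r")
    proof
      assume ?l then show ?r by (force elim!: nsets2_E simp: doubleton_eq_iff)
    next
      assume ?r
      then obtain x y where "x \<noteq> y" "x < n" "y < n" "u = Inl x" "v = Inl y" by blast
      then show ?l by (intro image_eqI[of _ _ "{x, y}"]) auto
    qed
    have 2: "{u, v} \<in> image Inr ` [{..<m}]\<^bsup>2\<^esup> \<longleftrightarrow>
      (\<exists>x y. x \<noteq> y \<and> x < m \<and> y < m \<and> u = Inr x \<and> v = Inr y)" (is "?l \<longleftrightarrow> ?r")
    proof
      assume ?l then show ?r by (force elim!: nsets2_E simp: doubleton_eq_iff)
    next
      assume ?r
      then obtain x y where "x \<noteq> y" "x < m" "y < m" "u = Inr x" "v = Inr y" by blast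
      then show ?l by (intro image_eqI[of _ _ "{x, y}"]) auto
    qed
    show ?thesis
      using 1 2 by (simp add: disjoint_union_def complete_graph_def)
  qed
  have "isomorphic ?H ?F"
    unfolding isomorphic_def
  proof (intro exI[of _ ?h] conjI ballI)
    show "bij_betw ?h (verts ?H) (verts ?F)" by (rule bij)
    fix u v assume uv: "u \<in> verts ?H" "v \<in> verts ?H"
    have "f x \<notin> D" if "x < n" for x using img(1)[OF that] disj by blast
    moreover have "g x \<notin> C" if "x < m" for x using img'(1)[OF that] disj by blast
    ultimately show "{u, v} \<in> edges ?H \<longleftrightarrow> {?h u, ?h v} \<in> edges ?F"
      using uv img img' unfolding edgesH vertsH by (auto 4 3)
  qed
  with F edgesF G C(1) D(1) show ?thesis
    unfolding monochromatic_copy_iff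
    by (intro conjI exI[of _ ?F] exI[of _ k]) (auto simp: mono_clique_def)
qed

subsection \<open>The recolouring\<close>

text \<open>
  For \<open>k = Red\<close>, \<open>A\<close> is the set recoloured blue inside. The last clause prevents a blue clique
  containing all of \<open>A\<close>, except possibly \<open>p\<close> or \<open>q\<close>, from using a vertex outside the recoloured sets.
\<close>

definition control ::
  "'v graph \<Rightarrow> ('v set \<Rightarrow> colour) \<Rightarrow> nat \<Rightarrow> colour \<Rightarrow> 'v set \<Rightarrow> ('v \<Rightarrow> 'v set) \<Rightarrow> 'v \<Rightarrow> 'v \<Rightarrow> bool"
  where
  "control G c n k A f p q \<longleftrightarrow>
     finite A \<and> card A \<le> n - 1 \<and>
     (\<forall>a\<in>A. \<forall>u\<in>f a. \<forall>v\<in>f a. u \<noteq> v \<longrightarrow> c {u, v} = k) \<and>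
     (\<forall>a\<in>A. \<forall>Q. mono_clique G c k Q \<and> card Q = n - 1 \<and> Q \<inter> A = {} \<longrightarrow> Q \<inter> f a \<noteq> {}) \<and>
     (card A = n - 1 \<longrightarrow> (\<forall>w. \<forall>r\<in>{p, q}. \<exists>a\<in>A - {r}. w \<notin> f a))"

text \<open>Formulated for one colour \<open>k\<close>, so that exchanging \<open>A\<close> and
  \<open>B\<close> settles the other. If \<open>C\<close> misses \<open>B\<close>, the sets
  \<open>f a\<close> rule it out; if \<open>C\<close> meets \<open>B\<close>, counting forces it to
  contain nearly all of \<open>B\<close> and one outside vertex, which the last clause of
  \<open>control\<close> forbids.\<close>

lemma recoloured_no_mono_clique:
  assumes "n \<ge> 4" and disj: "A \<inter> B = {}"
    and A: "control G c n k A f p q" and B: "control G c n l B g s t" and "k \<noteq> l"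
    and inA: "\<And>a b. a \<in> A \<Longrightarrow> b \<in> A \<Longrightarrow> a \<noteq> b \<Longrightarrow> d {a, b} \<noteq> k"
    and Aout: "\<And>a w. a \<in> A \<Longrightarrow> w \<notin> A \<union> B \<Longrightarrow> w \<in> f a \<Longrightarrow> d {a, w} \<noteq> k"
    and Bout: "\<And>b w. b \<in> B \<Longrightarrow> w \<notin> A \<union> B \<Longrightarrow> w \<notin> g b \<Longrightarrow> d {b, w} \<noteq> k"
    and out: "\<And>u v. u \<notin> A \<union> B \<Longrightarrow> v \<notin> A \<union> B \<Longrightarrow> d {u, v} = c {u, v}"
    and cross: "\<And>a. a \<in> A \<Longrightarrow> B \<noteq> {} \<Longrightarrow> \<exists>r\<in>{s, t}. r \<in> B \<and> d {a, r} \<noteq> k"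
    and hit: "\<And>Q. mono_clique G c k Q \<Longrightarrow> card Q = n \<Longrightarrow> Q \<inter> (A \<union> B) \<noteq> {}"
    and C: "mono_clique G d k C" "card C = n"
  shows False
proof -
  have fin: "finite C" using C(2) \<open>n \<ge> 4\<close> by (metis card.infinite not_numeral_le_zero)
  have finB: "finite B" and cardB: "card B \<le> n - 1" using B by (auto simp: control_def)
  have colC: "d {u, v} = k" if "u \<in> C" "v \<in> C" "u \<noteq> v" for u v
    using mono_clique_colour[OF C(1)] that by blast
  have orig: "mono_clique G c k D" if "D \<subseteq> C" "D \<inter> (A \<union> B) = {}" for D
  proof -
    have "mono_clique G d k D" using C(1) that(1) by (rule mono_clique_subset)
    moreover have "mono_clique G d k D \<longleftrightarrow> mono_clique G c k D"
      using that(2) by (intro mono_clique_cong out) auto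
    ultimately show ?thesis by blast
  qed
  have CA: "a = b" if "a \<in> C \<inter> A" "b \<in> C \<inter> A" for a b
    using inA[of a b] colC[of a b] that by blast
  show False
  proof (cases "C \<inter> B = {}")
    case True
    \<comment> \<open>If \<open>C\<close> avoided \<open>A\<close> as well, it would be a clique of
      \<open>c\<close> on \<open>n\<close> vertices, against \<open>hit\<close>.\<close>
    then obtain a where a: "a \<in> C" "a \<in> A"
      using hit[OF orig[of C]] C(2) by blast
    have avoid: "(C - {a}) \<inter> (A \<union> B) = {}" using CA a True by blast
    have "mono_clique G c k (C - {a})" using avoid by (intro orig) auto
    moreover have "card (C - {a}) = n - 1" using a C(2) by simp
    ultimately have "(C - {a}) \<inter> f a \<noteq> {}"
      using A a avoid unfolding control_def by blast
    then obtain w where w: "w \<in> C" "w \<noteq> a" "w \<in> f a" by blast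
    then show False
      using Aout[of a w] colC[of a w] a avoid by blast
  next
    case False
    then obtain b where b: "b \<in> C" "b \<in> B" by blast
    let ?W = "C - A - B"
    have Wg: "w \<in> g r" if "w \<in> ?W" "r \<in> C \<inter> B" for w r
      using Bout[of r w] colC[of r w] that by blast
    have "u = v" if "u \<in> ?W" "v \<in> ?W" for u v
    proof (rule ccontr)
      assume "u \<noteq> v"
      then have "c {u, v} = l"
        using B b Wg[of _ b] that unfolding control_def by blast
      moreover have "c {u, v} = k"
        using out[of u v] colC[of u v] that \<open>u \<noteq> v\<close> by auto
      ultimately show False using \<open>k \<noteq> l\<close> by simp
    qed
    then have cW: "card ?W \<le> 1" using fin by (simp add: card_le_Suc0_iff_eq)
    have cA: "card (C \<inter> A) \<le> 1" using fin CA by (simp add: card_le_Suc0_iff_eq)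
    have sum: "n = card (C \<inter> A) + card (C \<inter> B) + card ?W"
    proof -
      have "C = (C \<inter> A) \<union> (C \<inter> B) \<union> ?W" by blast
      moreover have "card ((C \<inter> A) \<union> (C \<inter> B) \<union> ?W) = card (C \<inter> A) + card (C \<inter> B) + card ?W"
        using fin disj by (subst card_Un_disjoint; (subst card_Un_disjoint)?) auto
      ultimately show ?thesis using C(2) by metis
    qed
    \<comment> \<open>The upper bounds add up to exactly \<open>n\<close>, as
      \<open>(n - 1) + 1\<close> or as \<open>1 + (n - 2) + 1\<close>, so each is attained.\<close>
    have "\<exists>r\<in>{s, t}. B - {r} \<subseteq> C \<and> card B = n - 1 \<and> card ?W = 1"
    proof (cases "C \<inter> A = {}")
      case True
      have le: "card (C \<inter> B) \<le> card B" using finB by (intro card_mono) auto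
      have *: "card (C \<inter> B) = card B" "card B = n - 1" "card ?W = 1"
        using sum cW le cardB True \<open>n \<ge> 4\<close> by auto
      have "C \<inter> B = B" using *(1) finB by (intro card_subset_eq) auto
      then show ?thesis using * by blast
    next
      case False
      then obtain a where a: "a \<in> C" "a \<in> A" by blast
      then obtain r where r: "r \<in> {s, t}" "r \<in> B" "d {a, r} \<noteq> k"
        using cross[of a] b by blast
      have sub: "C \<inter> B \<subseteq> B - {r}" using r colC[of a r] a disj by blast
      then have le: "card (C \<inter> B) \<le> card (B - {r})" using finB by (intro card_mono) auto
      have Br: "card (B - {r}) = card B - 1" using r finB by simp
      have *: "card (C \<inter> B) = card (B - {r})" "card B = n - 1" "card ?W = 1"
        using sum cW cA le cardB Br \<open>n \<ge> 4\<close> by linarith+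
      have "C \<inter> B = B - {r}" using *(1) sub finB by (intro card_subset_eq) auto
      then show ?thesis using * r by blast
    qed
    then obtain r where r: "r \<in> {s, t}" "B - {r} \<subseteq> C" "card B = n - 1" "card ?W = 1"
      by blast
    obtain w where w: "?W = {w}" using r(4) card_1_singletonE by blast
    obtain a where "a \<in> B - {r}" "w \<notin> g a"
      using B r unfolding control_def by blast
    then show False using Wg[of w a] w r(2) by blast
  qed
qed

text \<open>If \<open>A\<close> or \<open>B\<close> is empty, no edges run between them and nothing
  has to be balanced; hence the alternatives in \<open>pq\<close>.\<close>

lemma recolouring:
  assumes n: "n \<ge> 4" and disj: "A \<inter> B = {}"
    and A: "control G c n Red A f p q" and B: "control G c n Blue B g s t"
    and pq: "A = {} \<or> B = {} \<or> p \<in> A \<and> q \<in> A \<and> p \<noteq> q \<and> s \<in> B \<and> t \<in> B \<and> s \<noteq> t"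
    and hit: "\<And>k Q. mono_clique G c k Q \<Longrightarrow> card Q = n \<Longrightarrow> Q \<inter> (A \<union> B) \<noteq> {}"
  shows "\<exists>d. \<forall>k C. mono_clique G d k C \<longrightarrow> card C \<noteq> n"
proof -
  \<comment> \<open>\<open>M\<close> is the blue bipartite graph between \<open>A\<close> and \<open>B\<close>: every \<open>a\<close> has a blue neighbour in
    \<open>{s, t}\<close> and every \<open>b\<close> a red one in \<open>{p, q}\<close>. Such a graph needs two vertices on each side,
    which is where \<open>n \<ge> 4\<close> enters.\<close>
  define M where "M a b \<longleftrightarrow> (if a = q then b = t else b = s)" for a b
  \<comment> \<open>A colouring acts on unordered pairs, so \<open>d\<close> is given by its red
    class rather than by cases on the endpoints.\<close>
  define R where "R = {e. e \<subseteq> B}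
     \<union> {{a, w} |a w. a \<in> A \<and> w \<notin> A \<union> B \<and> w \<notin> f a}
     \<union> {{b, w} |b w. b \<in> B \<and> w \<notin> A \<union> B \<and> w \<in> g b}
     \<union> {{a, b} |a b. a \<in> A \<and> b \<in> B \<and> \<not> M a b}
     \<union> {e. e \<inter> (A \<union> B) = {} \<and> c e = Red}"
  define d where "d e = (if e \<in> R then Red else Blue)" for e
  have d_A: "d {a, b} = Blue" if "a \<in> A" "b \<in> A" for a b
    using that disj unfolding d_def R_def by (auto simp: doubleton_eq_iff)
  have d_B: "d {a, b} = Red" if "a \<in> B" "b \<in> B" for a b
    using that disj unfolding d_def R_def by (auto simp: doubleton_eq_iff)
  have d_Aw: "d {a, w} = (if w \<in> f a then Blue else Red)" if "a \<in> A" "w \<notin> A \<union> B" for a w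
    using that disj unfolding d_def R_def by (auto simp: doubleton_eq_iff)
  have d_Bw: "d {b, w} = (if w \<in> g b then Red else Blue)" if "b \<in> B" "w \<notin> A \<union> B" for b w
    using that disj unfolding d_def R_def by (auto simp: doubleton_eq_iff)
  have d_AB: "d {a, b} = (if M a b then Blue else Red)" if "a \<in> A" "b \<in> B" for a b
  proof -
    have "a \<notin> B" "b \<notin> A" using that disj by auto
    then show ?thesis
      using that unfolding d_def R_def by (auto simp: doubleton_eq_iff)
  qed
  have d_out: "d {u, v} = c {u, v}" if "u \<notin> A \<union> B" "v \<notin> A \<union> B" for u v
    using that unfolding d_def R_def by (cases "c {u, v}") (auto simp: doubleton_eq_iff)
  have "card C \<noteq> n" if C: "mono_clique G d k C" for k C
  proof
    assume cC: "card C = n"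
    show False
    proof (cases k)
      case Red
      show False
      proof (rule recoloured_no_mono_clique[OF n disj A B _ _ _ _ _ _ hit C[unfolded Red] cC])
        fix a assume "a \<in> A" "B \<noteq> {}"
        then show "\<exists>r\<in>{s, t}. r \<in> B \<and> d {a, r} \<noteq> Red"
          using pq d_AB by (cases "a = q") (auto simp: M_def)
      qed (use d_A d_Aw d_Bw d_out in auto)
    next
      case Blue
      show False
      proof (rule recoloured_no_mono_clique[OF n _ B A _ _ _ _ _ _ _ C[unfolded Blue] cC])
        fix b assume "b \<in> B" "A \<noteq> {}"
        then have pq': "p \<in> A" "q \<in> A" "p \<noteq> q" "s \<noteq> t" using pq by auto
        \<comment> \<open>The red neighbour is \<open>q\<close> for \<open>b = s\<close> and
          \<open>p\<close> for every other \<open>b\<close>.\<close>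
        show "\<exists>r\<in>{p, q}. r \<in> A \<and> d {b, r} \<noteq> Blue"
          using pq' d_AB[of p b] d_AB[of q b] \<open>b \<in> B\<close>
          by (cases "b = s") (auto simp: M_def insert_commute)
      qed (use disj d_B d_Aw d_Bw d_out hit in \<open>auto simp: Un_commute\<close>)
    qed
  qed
  then show ?thesis by blast
qed

subsection \<open>Choosing the recoloured sets\<close>

text \<open>The absence of a monochromatic disjoint union, expressed through vertex sets.\<close>

locale clique_intersecting =
  fixes G :: "'v graph" and c :: "'v set \<Rightarrow> colour" and n :: nat
  assumes n4: "n \<ge> 4"
    and meet: "\<And>k C D. mono_clique G c k C \<Longrightarrow> card C = n \<Longrightarrow>
      mono_clique G c k D \<Longrightarrow> card D = n - 1 \<Longrightarrow> C \<inter> D \<noteq> {}"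
begin

abbreviation big :: "colour \<Rightarrow> 'v set \<Rightarrow> bool" where
  "big k S \<equiv> mono_clique G c k S \<and> card S = n"

lemma big_finite: "big k S \<Longrightarrow> finite S"
  using n4 by (metis card.infinite not_numeral_le_zero)

text \<open>\<open>Q - {x}\<close> still contains a clique on \<open>n - 1\<close> vertices, and
  \<open>S\<close> must meet it outside \<open>x\<close>.\<close>

lemma big_meet_remove:
  assumes "big k S" "big k Q"
  shows "Q \<inter> (S - {x}) \<noteq> {}"
proof -
  have fin: "finite Q" using assms(2) by (rule big_finite)
  have "\<exists>D. D \<subseteq> Q - {x} \<and> card D = n - 1"
    using assms(2) fin by (metis card_Diff_singleton_if diff_le_self le_refl obtain_subset_with_card_n)
  then obtain D where D: "D \<subseteq> Q - {x}" "card D = n - 1" by blast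
  then have "mono_clique G c k D"
    using assms(2) mono_clique_subset by blast
  then show ?thesis using meet[of k S D] D assms(1) by blast
qed

text \<open>A clique on \<open>n - 1\<close> vertices avoiding \<open>S - {x}\<close> meets
  \<open>S\<close> only in \<open>x\<close>, and therefore meets \<open>S'\<close> in
  \<open>S' - S\<close>. So \<open>{x}\<close> and \<open>S' - S\<close> are both admissible values
  of \<open>f\<close>.\<close>

lemma control_remove1:
  assumes S: "big k S" and S': "big k S'" and x: "x \<in> S" "x \<notin> S'"
  shows "\<exists>f p q. control G c n k (S - {x}) f p q \<and> p \<in> S - {x} \<and> q \<in> S - {x} \<and> p \<noteq> q"
proof -
  have fin: "finite S" using S by (rule big_finite)
  have card: "card (S - {x}) = n - 1" using S x fin by simp
  have "3 \<le> card (S - {x})" using card n4 by linarith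
  then obtain T where "T \<subseteq> S - {x}" "card T = 3" by (rule obtain_subset_with_card_n)
  then obtain p q r where pqr: "p \<in> S - {x}" "q \<in> S - {x}" "r \<in> S - {x}"
      "p \<noteq> q" "p \<noteq> r" "q \<noteq> r"
    by (auto simp: card_3_iff)
  \<comment> \<open>Deleting \<open>p\<close> or \<open>q\<close> leaves \<open>r\<close> and the
    other one; their values of \<open>f\<close> are disjoint, so no \<open>w\<close> lies in
    both.\<close>
  define f where "f a = (if a = r then {x} else S' - S)" for a
  have "control G c n k (S - {x}) f p q"
    unfolding control_def
  proof (intro conjI ballI allI impI)
    fix a u v assume "a \<in> S - {x}" "u \<in> f a" "v \<in> f a" "u \<noteq> v"
    then show "c {u, v} = k"
      using S' by (auto simp: f_def mono_clique_def split: if_splits)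
  next
    fix a Q assume "a \<in> S - {x}" and Q: "mono_clique G c k Q \<and> card Q = n - 1 \<and> Q \<inter> (S - {x}) = {}"
    have "S \<inter> Q \<noteq> {}" "S' \<inter> Q \<noteq> {}" using meet S S' Q by blast+
    then show "Q \<inter> f a \<noteq> {}" using Q x by (auto simp: f_def)
  next
    fix w v assume "v \<in> {p, q}"
    then obtain b where b: "b \<in> {p, q}" "b \<noteq> v" using pqr by blast
    have "w \<notin> f r \<or> w \<notin> f b" using b pqr x by (auto simp: f_def)
    then show "\<exists>a\<in>S - {x} - {v}. w \<notin> f a" using b pqr \<open>v \<in> {p, q}\<close> by blast
  qed (use fin card in auto)
  then show ?thesis using pqr by blast
qed

lemma control_exists:
  assumes S: "big k S"
  shows "\<exists>A f p q. A \<subseteq> S \<and> control G c n k A f p q \<and> p \<in> A \<and> q \<in> A \<and> p \<noteq> q \<and>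
    (\<forall>Q. big k Q \<longrightarrow> Q \<inter> A \<noteq> {})"
proof (cases "\<exists>S'. big k S' \<and> S' \<noteq> S")
  case True
  then obtain S' where S': "big k S'" "S' \<noteq> S" by blast
  have "\<not> S \<subseteq> S'" using S S' big_finite[of k S'] by (metis card_subset_eq)
  then obtain x where "x \<in> S" "x \<notin> S'" by blast
  then show ?thesis
    using control_remove1[OF S S'(1)] big_meet_remove[OF S] by (meson Diff_subset)
next
  case False
  have fin: "finite S" using S by (rule big_finite)
  have "2 \<le> card S" using S n4 by linarith
  \<comment> \<open>Removing two vertices brings the size to \<open>n - 2\<close>, below the size at
    which the last clause of \<open>control\<close> demands anything, and still leaves room for
    \<open>p\<close> and \<open>q\<close>.\<close>
  then obtain T where T: "T \<subseteq> S" "card T = 2" by (rule obtain_subset_with_card_n)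
  have card: "card (S - T) = n - 2"
    using S T fin by (simp add: card_Diff_subset finite_subset)
  have "2 \<le> card (S - T)" using card n4 by linarith
  then obtain P where "P \<subseteq> S - T" "card P = 2" by (rule obtain_subset_with_card_n)
  then obtain p q where pq: "p \<in> S - T" "q \<in> S - T" "p \<noteq> q" by (auto simp: card_2_iff)
  have "control G c n k (S - T) (\<lambda>_. T) p q"
    unfolding control_def
  proof (intro conjI ballI allI impI)
    fix u v assume "u \<in> T" "v \<in> T" "u \<noteq> v"
    then show "c {u, v} = k" using S T by (auto simp: mono_clique_def)
  next
    fix Q assume Q: "mono_clique G c k Q \<and> card Q = n - 1 \<and> Q \<inter> (S - T) = {}"
    then have "S \<inter> Q \<noteq> {}" using meet S by blast
    then show "Q \<inter> T \<noteq> {}" using Q by blast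
  qed (use fin card n4 in auto)
  moreover have "\<forall>Q. big k Q \<longrightarrow> Q \<inter> (S - T) \<noteq> {}" using False pq by blast
  ultimately show ?thesis using pq by (meson Diff_subset)
qed

text \<open>Since \<open>S'\<close> misses \<open>v\<close>, the removed vertex can be
  \<open>v\<close> itself; this frees \<open>v\<close> for a clique of the other colour.\<close>

lemma control_exists_avoiding:
  assumes S: "big k S" and "v \<in> S" and S': "big k S'" "v \<notin> S'"
  shows "\<exists>A f p q. A \<subseteq> S - {v} \<and> control G c n k A f p q \<and> p \<in> A \<and> q \<in> A \<and> p \<noteq> q \<and>
    (\<forall>Q. big k Q \<longrightarrow> Q \<inter> A \<noteq> {})"
  using control_remove1[OF S S'(1) assms(2) S'(2)] big_meet_remove[OF S] by (meson order_refl)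

lemma control_empty: "control G c n k {} f p q"
  using n4 by (simp add: control_def)

text \<open>A clique avoiding \<open>v\<close> meets \<open>S\<close> in \<open>S - {v}\<close>. The
  values \<open>v v\<close> are mere defaults, as \<open>1 < n - 1\<close>.\<close>

lemma control_singleton:
  assumes "big k S" "v \<in> S"
  shows "control G c n k {v} (\<lambda>_. S - {v}) v v"
  unfolding control_def
proof (intro conjI ballI allI impI)
  fix u w assume "u \<in> S - {v}" "w \<in> S - {v}" "u \<noteq> w"
  then show "c {u, w} = k" using assms by (auto simp: mono_clique_def)
next
  fix Q assume Q: "mono_clique G c k Q \<and> card Q = n - 1 \<and> Q \<inter> {v} = {}"
  then have "S \<inter> Q \<noteq> {}" using meet assms by blast
  then show "Q \<inter> (S - {v}) \<noteq> {}" using Q by blast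
qed (use n4 in auto)

lemma clique_free_recolouring: "\<exists>d. \<forall>k C. mono_clique G d k C \<longrightarrow> card C \<noteq> n"
proof -
  consider (none) "\<And>k S. \<not> big k S"
    | (red) S where "big Red S" "\<And>S. \<not> big Blue S"
    | (blue) S where "big Blue S" "\<And>S. \<not> big Red S"
    | (both) S T where "big Red S" "big Blue T"
    by (metis colour.exhaust)
  then show ?thesis
  proof cases
    case none
    then show ?thesis by blast
  next
    case red
    obtain A f p q where A: "control G c n Red A f p q" "\<forall>Q. big Red Q \<longrightarrow> Q \<inter> A \<noteq> {}"
      using control_exists[OF red(1)] by blast
    show ?thesis
    proof (rule recolouring[OF n4 _ A(1) control_empty])
      fix k Q assume "mono_clique G c k Q" "card Q = n"
      then show "Q \<inter> (A \<union> {}) \<noteq> {}" using A(2) red(2) by (cases k) auto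
    qed auto
  next
    case blue
    obtain A f p q where A: "control G c n Blue A f p q" "\<forall>Q. big Blue Q \<longrightarrow> Q \<inter> A \<noteq> {}"
      using control_exists[OF blue(1)] by blast
    show ?thesis
    proof (rule recolouring[OF n4 _ control_empty A(1)])
      fix k Q assume "mono_clique G c k Q" "card Q = n"
      then show "Q \<inter> ({} \<union> A) \<noteq> {}" using A(2) blue(2) by (cases k) auto
    qed auto
  next
    case both
    \<comment> \<open>Two common vertices would span an edge that is both red and blue.\<close>
    have inter: "u = v" if "u \<in> S \<inter> T" "v \<in> S \<inter> T" for u v
      using both that mono_clique_colour[of G c _ _ u v] by (metis IntE colour.distinct(1))
    have combine: ?thesis
      if "A \<inter> B = {}" "control G c n Red A f p q" "control G c n Blue B g s t"
        "p \<in> A" "q \<in> A" "p \<noteq> q" "s \<in> B" "t \<in> B" "s \<noteq> t"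
        "\<forall>Q. big Red Q \<longrightarrow> Q \<inter> A \<noteq> {}" "\<forall>Q. big Blue Q \<longrightarrow> Q \<inter> B \<noteq> {}" for A B f g p q s t
    proof (rule recolouring[OF n4 that(1-3)])
      fix k Q assume "mono_clique G c k Q" "card Q = n"
      then show "Q \<inter> (A \<union> B) \<noteq> {}" using that(10,11) by (cases k) blast+
    qed (use that in auto)
    obtain A f p q where A: "A \<subseteq> S" "control G c n Red A f p q" "p \<in> A" "q \<in> A" "p \<noteq> q"
        "\<forall>Q. big Red Q \<longrightarrow> Q \<inter> A \<noteq> {}"
      using control_exists[OF both(1)] by blast
    obtain B g s t where B: "B \<subseteq> T" "control G c n Blue B g s t" "s \<in> B" "t \<in> B" "s \<noteq> t"
        "\<forall>Q. big Blue Q \<longrightarrow> Q \<inter> B \<noteq> {}"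
      using control_exists[OF both(2)] by blast
    show ?thesis
    proof (cases "S \<inter> T = {}")
      case True
      then have "A \<inter> B = {}" using A(1) B(1) by blast
      then show ?thesis using combine A B by blast
    next
      case False
      then obtain v where v: "v \<in> S" "v \<in> T" by blast
      \<comment> \<open>If some clique on \<open>n\<close> vertices avoids \<open>v\<close>, the set
        for its colour can be chosen off \<open>v\<close>; otherwise \<open>{v}\<close> alone meets
        all of them.\<close>
      consider S' where "big Red S'" "v \<notin> S'" | T' where "big Blue T'" "v \<notin> T'"
        | (all) "\<And>k Q. big k Q \<Longrightarrow> v \<in> Q"
        by (metis colour.exhaust)
      then show ?thesis
      proof cases
        case 1
        obtain A' f' p' q' where A': "A' \<subseteq> S - {v}" "control G c n Red A' f' p' q'"
            "p' \<in> A'" "q' \<in> A'" "p' \<noteq> q'" "\<forall>Q. big Red Q \<longrightarrow> Q \<inter> A' \<noteq> {}"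
          using control_exists_avoiding[OF both(1) v(1) 1] by blast
        have "A' \<inter> B = {}" using A'(1) B(1) inter v by blast
        then show ?thesis using combine A' B by blast
      next
        case 2
        obtain B' g' s' t' where B': "B' \<subseteq> T - {v}" "control G c n Blue B' g' s' t'"
            "s' \<in> B'" "t' \<in> B'" "s' \<noteq> t'" "\<forall>Q. big Blue Q \<longrightarrow> Q \<inter> B' \<noteq> {}"
          using control_exists_avoiding[OF both(2) v(2) 2] by blast
        have "A \<inter> B' = {}" using B'(1) A(1) inter v by blast
        then show ?thesis using combine A B' by blast
      next
        case all
        show ?thesis
          by (rule recolouring[OF n4 _ control_singleton[OF both(1) v(1)] control_empty])
            (use all in auto)
      qed
    qed
  qed
qed

end

section \<open>Ramsey equivalence\<close>

theorem theorem1: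
  fixes n :: nat
  assumes "n \<ge> 4"
  shows "ramsey_equivalent TYPE('v)
           (complete_graph n) (disjoint_union (complete_graph n) (complete_graph (n - 1)))"
  unfolding ramsey_equivalent_def
proof (intro allI impI iffI)
  let ?H = "disjoint_union (complete_graph n) (complete_graph (n - 1))"
  fix G :: "'v graph" assume G: "simple_graph G"
  {
    assume r: "ramsey G (complete_graph n)"
    show "ramsey G ?H"
      unfolding ramsey_def
    proof (rule allI, rule ccontr)
      fix c assume no: "\<not> monochromatic_copy c ?H G"
      have fin: "finite C" if "mono_clique G d k C" for d k C
        using that G by (auto simp: mono_clique_def simple_graph_def intro: finite_subset)
      \<comment> \<open>Disjoint cliques violating \<open>meet\<close> would form the copy excluded
        by \<open>no\<close>.\<close>
      interpret clique_intersecting G c n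
        by unfold_locales (use assms no mono_cliques_imp_copy[OF G] fin in blast)+
      obtain d where "\<forall>k C. mono_clique G d k C \<longrightarrow> card C \<noteq> n"
        using clique_free_recolouring by blast
      moreover have "monochromatic_copy d (complete_graph n) G"
        using r by (simp add: ramsey_def)
      ultimately show False
        using copy_imp_mono_clique[of d "complete_graph n" G "{..<n}"]
        by (auto simp: complete_graph_def)
    qed
  next
    assume r: "ramsey G ?H"
    show "ramsey G (complete_graph n)"
      unfolding ramsey_def
    proof
      fix c
      have "monochromatic_copy c ?H G" using r by (simp add: ramsey_def)
      \<comment> \<open>The left summand is a copy of the complete graph on \<open>n\<close>
        vertices inside the union.\<close>
      moreover have "[Inl ` {..<n}]\<^bsup>2\<^esup> \<subseteq> edges ?H"
      proof
        fix e :: "(nat + nat) set" assume "e \<in> [Inl ` {..<n}]\<^bsup>2\<^esup>"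
        then obtain x y where "x \<noteq> y" "x < n" "y < n" "e = Inl ` {x, y}"
          by (auto elim!: nsets2_E)
        then show "e \<in> edges ?H"
          unfolding disjoint_union_def complete_graph_def by (auto intro!: imageI)
      qed
      moreover have "Inl ` {..<n} \<subseteq> verts ?H"
        by (auto simp: disjoint_union_def complete_graph_def)
      ultimately obtain k C where "mono_clique G c k C" "card C = card (Inl ` {..<n} :: (nat + nat) set)" "finite C"
        using copy_imp_mono_clique[of c ?H G "Inl ` {..<n}"] by blast
      then show "monochromatic_copy c (complete_graph n) G"
        using mono_clique_imp_copy[OF G] by (simp add: card_image)
    qed
  }
qed

end
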